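(* For every $k\geq3$ there is a bipartite graph $G$ such that $\mathrm{stw}(G)+1\leq k+1\leq\mathrm{ca}(G)=t(G)$.
   Context: All graphs are finite and simple. A simple $k$-tree is a graph obtainable by starting with a $(k+1)$-clique and repeatedly adding a new vertex adjacent exactly to the vertices of some $k$-clique of the current graph, such that no two vertices are added onto the same $k$-clique; $\mathrm{stw}(G)$ is the minimum $k$ such that $G$ is a subgraph of some simple $k$-tree. A caterpillar is a tree whose non-leaf vertices form a path; the caterpillar arboricity $\mathrm{ca}(G)$ is the minimum number of caterpillar forests (subgraphs of $G$) whose edge sets cover $E(G)$. The track-number $t(G)$ is the minimum number of interval graphs (subgraphs of $G$ that are intersection graphs of finite families of real intervals) whose edge sets cover $E(G)$. *)

theory Defs
  imports "HOL-Analysis.Analysis"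
begin

record 'a ugraph =
  verts :: "'a set"
  edges :: "'a set set"

definition simple_graph :: "'a ugraph \<Rightarrow> bool" where
  "simple_graph G \<longleftrightarrow>
     finite (verts G) \<and> (\<forall>e\<in>edges G. e \<subseteq> verts G \<and> card e = 2)"

definition subgraph :: "'a ugraph \<Rightarrow> 'a ugraph \<Rightarrow> bool" where
  "subgraph H G \<longleftrightarrow>
     simple_graph H \<and> simple_graph G \<and> verts H \<subseteq> verts G \<and> edges H \<subseteq> edges G"

definition induced :: "'a ugraph \<Rightarrow> 'a set \<Rightarrow> 'a ugraph" where
  "induced G W = \<lparr>verts = verts G \<inter> W, edges = {e \<in> edges G. e \<subseteq> W}\<rparr>"

definition bipartite :: "'a ugraph \<Rightarrow> bool" where
  "bipartite G \<longleftrightarrow> simple_graph G \<and>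
     (\<exists>A B. verts G = A \<union> B \<and> A \<inter> B = {} \<and>
        (\<forall>e\<in>edges G. \<exists>a\<in>A. \<exists>b\<in>B. e = {a, b}))"

definition clique :: "'a ugraph \<Rightarrow> 'a set \<Rightarrow> bool" where
  "clique G Q \<longleftrightarrow>
     Q \<subseteq> verts G \<and> (\<forall>u\<in>Q. \<forall>v\<in>Q. u \<noteq> v \<longrightarrow> {u, v} \<in> edges G)"

definition complete_graph :: "'a set \<Rightarrow> 'a ugraph" where
  "complete_graph K = \<lparr>verts = K, edges = {e. e \<subseteq> K \<and> card e = 2}\<rparr>"


(* The last argument records the k-cliques onto which a vertex has already been added. *)
inductive simple_ktree_constr :: "nat \<Rightarrow> 'a ugraph \<Rightarrow> 'a set set \<Rightarrow> bool" for k where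
  start: "finite K \<Longrightarrow> card K = k + 1 \<Longrightarrow> simple_ktree_constr k (complete_graph K) {}"
| add: "simple_ktree_constr k G U \<Longrightarrow> clique G Q \<Longrightarrow> card Q = k \<Longrightarrow> Q \<notin> U \<Longrightarrow> v \<notin> verts G \<Longrightarrow>
    simple_ktree_constr k
      \<lparr>verts = insert v (verts G), edges = edges G \<union> {{v, u} | u. u \<in> Q}\<rparr> (insert Q U)"

definition simple_ktree :: "nat \<Rightarrow> 'a ugraph \<Rightarrow> bool" where
  "simple_ktree k T \<longleftrightarrow> (\<exists>U. simple_ktree_constr k T U)"

(* The vertex type is infinite so that the host k-tree can always have extra vertices;
   hence being literally a subgraph is the same as being one up to isomorphism. *)
definition stw :: "nat ugraph \<Rightarrow> nat" where
  "stw G = (LEAST k. \<exists>T. simple_ktree k T \<and> subgraph G T)"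


definition reachable :: "'a ugraph \<Rightarrow> 'a \<Rightarrow> 'a \<Rightarrow> bool" where
  "reachable G = (\<lambda>u v. {u, v} \<in> edges G)\<^sup>*\<^sup>*"

definition connected_graph :: "'a ugraph \<Rightarrow> bool" where
  "connected_graph G \<longleftrightarrow>
     verts G \<noteq> {} \<and> (\<forall>u\<in>verts G. \<forall>v\<in>verts G. reachable G u v)"

definition path_edges :: "'a list \<Rightarrow> 'a set set" where
  "path_edges xs = {{xs ! i, xs ! Suc i} | i. Suc i < length xs}"

definition is_cycle :: "'a ugraph \<Rightarrow> 'a list \<Rightarrow> bool" where
  "is_cycle G xs \<longleftrightarrow>
     length xs \<ge> 3 \<and> distinct xs \<and> set xs \<subseteq> verts G \<and>
     path_edges xs \<subseteq> edges G \<and> {last xs, hd xs} \<in> edges G"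

definition tree :: "'a ugraph \<Rightarrow> bool" where
  "tree G \<longleftrightarrow> simple_graph G \<and> connected_graph G \<and> \<not> (\<exists>xs. is_cycle G xs)"

(* The empty list is allowed, so the graph without vertices counts as a path here;
   this is what makes the single edge a caterpillar. *)
definition path_graph :: "'a ugraph \<Rightarrow> bool" where
  "path_graph G \<longleftrightarrow>
     (\<exists>xs. distinct xs \<and> verts G = set xs \<and> edges G = path_edges xs)"

definition degree :: "'a ugraph \<Rightarrow> 'a \<Rightarrow> nat" where
  "degree G v = card {e \<in> edges G. v \<in> e}"

definition leaf :: "'a ugraph \<Rightarrow> 'a \<Rightarrow> bool" where
  "leaf G v \<longleftrightarrow> v \<in> verts G \<and> degree G v = 1"

definition caterpillar :: "'a ugraph \<Rightarrow> bool" where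
  "caterpillar G \<longleftrightarrow>
     tree G \<and> path_graph (induced G {v \<in> verts G. \<not> leaf G v})"

definition caterpillar_forest :: "'a ugraph \<Rightarrow> bool" where
  "caterpillar_forest G \<longleftrightarrow> simple_graph G \<and>
     (\<forall>v\<in>verts G. caterpillar (induced G {u. reachable G v u}))"

definition interval_graph :: "'a ugraph \<Rightarrow> bool" where
  "interval_graph G \<longleftrightarrow> simple_graph G \<and>
     (\<exists>I :: 'a \<Rightarrow> real set.
        (\<forall>v\<in>verts G. is_interval (I v) \<and> I v \<noteq> {}) \<and>
        (\<forall>u\<in>verts G. \<forall>v\<in>verts G. u \<noteq> v \<longrightarrow>
           ({u, v} \<in> edges G \<longleftrightarrow> I u \<inter> I v \<noteq> {})))"

definition cover_number :: "('a ugraph \<Rightarrow> bool) \<Rightarrow> 'a ugraph \<Rightarrow> nat" where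
  "cover_number P G =
     (LEAST n. \<exists>\<H>. finite \<H> \<and> card \<H> = n \<and>
        (\<forall>H\<in>\<H>. P H \<and> subgraph H G) \<and> edges G = (\<Union>H\<in>\<H>. edges H))"

definition caterpillar_arboricity :: "'a ugraph \<Rightarrow> nat" where
  "caterpillar_arboricity = cover_number caterpillar_forest"

definition track_number :: "'a ugraph \<Rightarrow> nat" where
  "track_number = cover_number interval_graph"

end

theory Submission
  imports Defs
begin

text \<open>In a caterpillar forest, as in a triangle-free interval graph, every vertex has at most two
  neighbours that are not leaves. So if a vertex of huge degree is covered by boundedly many such
  graphs, most of its neighbours are leaves in the graphs covering the corresponding edges, and a
  leaf can use that graph for no other edge.

  Put \<open>q = k - 1\<close> and suppose that \<open>q + 1\<close> graphs suffice. Joining many vertices \<open>b\<close> to \<open>q\<close> vertices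
  \<open>a\<close> forces two consecutive ones, \<open>b\<close> and \<open>b'\<close>, to have a single graph left each, \<open>X\<close> and \<open>Y\<close>, for all
  their other edges. If \<open>X = Y\<close>, then three common neighbours \<open>c\<close> of \<open>b\<close> and \<open>b'\<close> are too many nonleaf
  neighbours of \<open>b\<close>. Otherwise all but four of the \<open>5q\<close> common neighbours are leaves in both \<open>X\<close> and
  \<open>Y\<close>, so one of five blocks of \<open>q\<close> of them has only \<open>q - 1\<close> graphs left for its edges to the vertices
  \<open>d\<close>, while a typical \<open>d\<close> needs \<open>q\<close> of them.

  Conversely the graph is a union of \<open>q + 2\<close> star forests, which are both caterpillar forests and
  interval graphs.\<close>

section \<open>Inner neighbours\<close>

definition inner_nbrs :: "'a ugraph \<Rightarrow> 'a \<Rightarrow> 'a set" where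
  "inner_nbrs H v = {u. {v, u} \<in> edges H \<and> (\<exists>w. w \<noteq> v \<and> {u, w} \<in> edges H)}"

text \<open>The only property of the covering graphs that the lower bound uses, so one argument
  serves both cover numbers. Finiteness is explicit because \<open>card\<close> of an infinite set
  is 0.\<close>

definition few_inner :: "'a ugraph \<Rightarrow> bool" where
  "few_inner H \<longleftrightarrow> (\<forall>v. finite (inner_nbrs H v) \<and> card (inner_nbrs H v) \<le> 2)"

lemma simple_graph_edgeD:
  assumes "simple_graph G" "{u, v} \<in> edges G"
  shows "u \<in> verts G" "v \<in> verts G" "u \<noteq> v"
proof -
  have "{u, v} \<subseteq> verts G" "card {u, v} = 2" using assms unfolding simple_graph_def by blast+
  then show "u \<in> verts G" "v \<in> verts G" "u \<noteq> v" by (auto simp: card_2_iff)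
qed

lemma finite_inner:
  assumes "simple_graph H"
  shows "finite (inner_nbrs H v)"
proof (rule finite_subset)
  show "inner_nbrs H v \<subseteq> verts H"
    using simple_graph_edgeD[OF assms] by (auto simp: inner_nbrs_def)
  show "finite (verts H)" using assms by (simp add: simple_graph_def)
qed

lemma card_gt_2_obtain:
  assumes "\<not> card S \<le> 2"
  obtains x y z where "x \<in> S" "y \<in> S" "z \<in> S" "x \<noteq> y" "x \<noteq> z" "y \<noteq> z"
proof -
  have "3 \<le> card S" using assms by simp
  then obtain T where "T \<subseteq> S" "card T = 3" by (metis obtain_subset_with_card_n)
  then show ?thesis using that unfolding card_3_iff by blast
qed

lemma few_innerI:
  assumes "simple_graph H"
    and "\<And>v x y z. \<lbrakk>x \<in> inner_nbrs H v; y \<in> inner_nbrs H v; z \<in> inner_nbrs H v;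
           x \<noteq> y; x \<noteq> z; y \<noteq> z\<rbrakk> \<Longrightarrow> False"
  shows "few_inner H"
  unfolding few_inner_def
proof (intro allI conjI)
  show "finite (inner_nbrs H v)" for v by (rule finite_inner[OF assms(1)])
  show "card (inner_nbrs H v) \<le> 2" for v
    by (rule ccontr) (erule card_gt_2_obtain, rule assms(2)[of _ v])
qed

text \<open>The points \<open>p\<close> and \<open>r\<close> lie outside \<open>I y\<close>, on
  either side of its point \<open>q\<close>. So \<open>I y\<close> is trapped between them, and that
  whole stretch belongs to \<open>I v\<close>.\<close>

lemma interval_inner_order:
  fixes I :: "'a \<Rightarrow> real set" and p q r s :: real
  assumes int: "is_interval (I v)" "is_interval (I y)"
    and p: "p \<in> I v" "p \<in> I x" and q: "q \<in> I v" "q \<in> I y" and r: "r \<in> I v" "r \<in> I z"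
    and disj: "I x \<inter> I y = {}" "I y \<inter> I z = {}" and ord: "p < q" "q < r" and s: "s \<in> I y"
  shows "s \<in> I v"
proof -
  have "p \<notin> I y" "r \<notin> I y" using p r disj by auto
  then have "p \<le> s" "s \<le> r"
    using int(2) q(2) s ord unfolding is_interval_1 by (meson le_cases less_imp_le)+
  then show ?thesis using int(1) p r unfolding is_interval_1 by blast
qed

text \<open>Two neighbours of \<open>v\<close> have disjoint intervals, as there is no triangle, so
  three of them are ordered along the line. For inner neighbours the middle interval lies inside
  \<open>I v\<close>, and its further neighbour would close a triangle with
  \<open>v\<close>.\<close>

lemma interval_graph_few_inner:
  assumes H: "interval_graph H"
    and tri: "\<And>u v w. {u, v} \<in> edges H \<Longrightarrow> {v, w} \<in> edges H \<Longrightarrow> {u, w} \<in> edges H \<Longrightarrow> False"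
  shows "few_inner H"
proof (rule few_innerI)
  show sg: "simple_graph H" using H by (simp add: interval_graph_def)
  obtain I :: "'a \<Rightarrow> real set" where
    I1: "\<And>v. v \<in> verts H \<Longrightarrow> is_interval (I v)" and
    I2: "\<And>u v. u \<in> verts H \<Longrightarrow> v \<in> verts H \<Longrightarrow> u \<noteq> v \<Longrightarrow> {u, v} \<in> edges H \<longleftrightarrow> I u \<inter> I v \<noteq> {}"
  proof -
    from H have "\<exists>I :: 'a \<Rightarrow> real set. (\<forall>v\<in>verts H. is_interval (I v) \<and> I v \<noteq> {}) \<and>
        (\<forall>u\<in>verts H. \<forall>v\<in>verts H. u \<noteq> v \<longrightarrow> ({u, v} \<in> edges H \<longleftrightarrow> I u \<inter> I v \<noteq> {}))"
      unfolding interval_graph_def by (rule conjunct2)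
    then show ?thesis by (elim exE conjE) (rule that, simp_all)
  qed
  note vs = simple_graph_edgeD[OF sg]
  have edge: "I u \<inter> I v \<noteq> {}" if "{u, v} \<in> edges H" for u v
    using I2[OF vs[OF that]] that by simp
  have disj: "I x \<inter> I y = {}" if "{v, x} \<in> edges H" "{v, y} \<in> edges H" "x \<noteq> y" for v x y
    using I2[of x y] vs[OF that(1)] vs[OF that(2)] that tri[of x v y] by (auto simp: insert_commute)
  have mid: False
    if mid: "x \<in> inner_nbrs H v" "y \<in> inner_nbrs H v" "z \<in> inner_nbrs H v" "x \<noteq> y" "y \<noteq> z"
      "p \<in> I v" "p \<in> I x" "q \<in> I v" "q \<in> I y" "r \<in> I v" "r \<in> I z" "p < q" "q < r"
    for v x y z p q r
  proof -
    obtain w where w: "w \<noteq> v" "{y, w} \<in> edges H" using mid(2) by (auto simp: inner_nbrs_def)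
    have e: "{v, x} \<in> edges H" "{v, y} \<in> edges H" "{v, z} \<in> edges H"
      using mid(1-3) by (auto simp: inner_nbrs_def)
    obtain s where s: "s \<in> I y" "s \<in> I w" using edge[OF w(2)] by auto
    have "s \<in> I v"
      by (rule interval_inner_order[of I v y p x q r z s])
        (use mid s e vs[OF e(2)] I1 disj in auto)
    moreover have "I v \<inter> I w = {}"
      using disj[of y v w] w e(2) by (auto simp: insert_commute)
    ultimately show False using s by auto
  qed
  show False if xyz: "x \<in> inner_nbrs H v" "y \<in> inner_nbrs H v" "z \<in> inner_nbrs H v" "x \<noteq> y" "x \<noteq> z" "y \<noteq> z"
    for v x y z
  proof -
    have e: "{v, x} \<in> edges H" "{v, y} \<in> edges H" "{v, z} \<in> edges H"
      using xyz(1-3) by (auto simp: inner_nbrs_def)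
    obtain p q r where pqr: "p \<in> I v" "p \<in> I x" "q \<in> I v" "q \<in> I y" "r \<in> I v" "r \<in> I z"
      using edge[OF e(1)] edge[OF e(2)] edge[OF e(3)] by blast
    have "p \<noteq> q" "p \<noteq> r" "q \<noteq> r"
      using pqr disj[OF e(1,2)] disj[OF e(1,3)] disj[OF e(2,3)] xyz by auto
    then consider "p < q" "q < r" | "p < r" "r < q" | "q < p" "p < r"
      | "q < r" "r < p" | "r < p" "p < q" | "r < q" "q < p" by linarith
    then show False
    proof cases
      case 1 show ?thesis by (rule mid[of x v y z p q r]) (use 1 xyz pqr in auto)
    next
      case 2 show ?thesis by (rule mid[of x v z y p r q]) (use 2 xyz pqr in auto)
    next
      case 3 show ?thesis by (rule mid[of y v x z q p r]) (use 3 xyz pqr in auto)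
    next
      case 4 show ?thesis by (rule mid[of y v z x q r p]) (use 4 xyz pqr in auto)
    next
      case 5 show ?thesis by (rule mid[of z v x y r p q]) (use 5 xyz pqr in auto)
    next
      case 6 show ?thesis by (rule mid[of z v y x r q p]) (use 6 xyz pqr in auto)
    qed
  qed
qed

lemma bipartite_no_triangle:
  assumes "bipartite G" "{u, v} \<in> edges G" "{v, w} \<in> edges G" "{u, w} \<in> edges G"
  shows False
proof -
  obtain A B where AB: "A \<inter> B = {}" "\<forall>e\<in>edges G. \<exists>a\<in>A. \<exists>b\<in>B. e = {a, b}"
    using assms(1) unfolding bipartite_def by blast
  have "(x \<in> A \<and> y \<in> B) \<or> (x \<in> B \<and> y \<in> A)" if "{x, y} \<in> edges G" for x y
    using AB(2) that by (fastforce simp: doubleton_eq_iff)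
  from this[OF assms(2)] this[OF assms(3)] this[OF assms(4)] AB(1) show False by auto
qed

text \<open>At an end of the list one of the candidates is a dummy: \<open>i - 1\<close> is 0 for
  \<open>i = 0\<close>, and \<open>Suc i\<close> may be out of range. Only the count of two matters
  later.\<close>

lemma path_edges_neighbours:
  assumes "distinct xs" "i < length xs" "{xs ! i, y} \<in> path_edges xs"
  shows "y = xs ! Suc i \<or> y = xs ! (i - 1)"
proof -
  obtain j where j: "Suc j < length xs" "{xs ! i, y} = {xs ! j, xs ! Suc j}"
    using assms(3) by (auto simp: path_edges_def)
  then consider "xs ! i = xs ! j" "y = xs ! Suc j" | "xs ! i = xs ! Suc j" "y = xs ! j"
    by (auto simp: doubleton_eq_iff)
  then show ?thesis
    using j assms(1,2) by cases (auto simp: nth_eq_iff_index_eq)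
qed

text \<open>A vertex with two inner neighbours is not a leaf, and neither are these neighbours. All
  of them lie on the path of non-leaves of one component, where a vertex has at most two
  neighbours.\<close>

lemma caterpillar_forest_few_inner:
  assumes H: "caterpillar_forest H"
  shows "few_inner H"
proof (rule few_innerI)
  show sg: "simple_graph H" using H by (simp add: caterpillar_forest_def)
  note vs = simple_graph_edgeD[OF sg]
  show False if xyz: "x \<in> inner_nbrs H v" "y \<in> inner_nbrs H v" "z \<in> inner_nbrs H v" "x \<noteq> y" "x \<noteq> z" "y \<noteq> z"
    for v x y z
  proof -
    define R where "R = {u. reachable H v u}"
    define C where "C = induced H R"
    have RI: "u \<in> R \<Longrightarrow> {u, w} \<in> edges H \<Longrightarrow> w \<in> R" for u w
      unfolding R_def reachable_def by (auto intro: rtranclp.rtrancl_into_rtrancl)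
    have vR: "v \<in> R" by (simp add: R_def reachable_def)
    have vx: "{v, x} \<in> edges H" "{v, y} \<in> edges H" using xyz by (auto simp: inner_nbrs_def)
    have "v \<in> verts H" using vs[OF vx(1)] by simp
    then have cat: "caterpillar C" using H by (simp add: caterpillar_forest_def C_def R_def)
    have finC: "finite (edges C)"
    proof (rule finite_subset)
      show "edges C \<subseteq> Pow (verts H)"
        using sg by (auto simp: C_def induced_def simple_graph_def)
      show "finite (Pow (verts H))" using sg by (simp add: simple_graph_def)
    qed
    define N where "N = {u \<in> verts C. \<not> leaf C u}"
    \<comment> \<open>Degrees are taken in \<open>C\<close>, which loses no edge at a vertex of
      \<open>R\<close> because \<open>R\<close> is closed under adjacency.\<close>
    have nl: "u \<in> N" if "u \<in> R" "{u, w} \<in> edges H" "{u, w'} \<in> edges H" "w \<noteq> w'" for u w w'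
    proof -
      have "{{u, w}, {u, w'}} \<subseteq> {e \<in> edges C. u \<in> e}"
        using that RI by (auto simp: C_def induced_def)
      from card_mono[OF _ this] finC have "2 \<le> degree C u"
        using that(4) by (simp add: degree_def doubleton_eq_iff)
      then show ?thesis using vs[OF that(2)] that(1) by (simp add: N_def C_def induced_def leaf_def)
    qed
    obtain xs where xs: "distinct xs" "verts (induced C N) = set xs" "edges (induced C N) = path_edges xs"
      using cat unfolding caterpillar_def path_graph_def N_def by blast
    have vN: "v \<in> N" using nl[OF vR vx] xyz by simp
    have "v \<in> set xs" using vN xs(2) by (auto simp: induced_def N_def)
    then obtain i where i: "i < length xs" "xs ! i = v" by (auto simp: in_set_conv_nth)
    have "u = xs ! Suc i \<or> u = xs ! (i - 1)" if u: "u \<in> inner_nbrs H v" for u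
    proof -
      obtain w where w: "{v, u} \<in> edges H" "w \<noteq> v" "{u, w} \<in> edges H"
        using u by (auto simp: inner_nbrs_def)
      have uR: "u \<in> R" using RI[OF vR w(1)] .
      have "u \<in> N" using nl[OF uR w(3), of v] w by (simp add: insert_commute)
      then have "{v, u} \<in> edges (induced C N)"
        using w vN uR vR by (auto simp: induced_def C_def)
      then show ?thesis using path_edges_neighbours[OF xs(1) i(1)] i xs(3) by simp
    qed
    from this[OF xyz(1)] this[OF xyz(2)] this[OF xyz(3)] xyz(4-6) show False by auto
  qed
qed

section \<open>Star forests\<close>

text \<open>\<open>S\<close> is the set of leaves and \<open>p\<close> sends a leaf to its centre; a centre may be isolated.\<close>

locale star_forest =
  fixes V S :: "'a set" and p :: "'a \<Rightarrow> 'a"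
  assumes finite_V: "finite V" and S_V: "S \<subseteq> V" and p_V: "\<And>v. v \<in> S \<Longrightarrow> p v \<in> V - S"
begin

definition "H = \<lparr>verts = V, edges = {{v, p v} | v. v \<in> S}\<rparr>"

lemma edge_iff: "{u, v} \<in> edges H \<longleftrightarrow> (u \<in> S \<and> v = p u) \<or> (v \<in> S \<and> u = p v)"
  by (auto simp: H_def doubleton_eq_iff)

lemma edge_S: "u \<in> S \<Longrightarrow> {u, v} \<in> edges H \<longleftrightarrow> v = p u"
  using p_V by (auto simp: edge_iff)

lemma simple: "simple_graph H"
proof -
  have "{v, p v} \<subseteq> V \<and> card {v, p v} = 2" if "v \<in> S" for v
    using that S_V p_V[OF that] by (auto intro!: card_2_iff[THEN iffD2] exI)
  then show ?thesis using finite_V by (auto simp: simple_graph_def H_def)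
qed

definition root :: "'a \<Rightarrow> 'a" where "root v = (if v \<in> S then p v else v)"

lemma root_edge: "{u, v} \<in> edges H \<Longrightarrow> root u = root v"
  using p_V by (auto simp: edge_iff root_def)

text \<open>An edge preserves \<open>root\<close>, and each vertex equals its root or is adjacent to
  it.\<close>

lemma reachable_root: "reachable H u v \<longleftrightarrow> root u = root v"
proof
  show "root u = root v" if "reachable H u v"
    using that unfolding reachable_def
    by (induction rule: rtranclp_induct) (use root_edge in auto)
  have 1: "reachable H u (root u)" "reachable H (root u) u" for u
    unfolding reachable_def root_def by (auto intro!: r_into_rtranclp simp: edge_iff)
  show "reachable H u v" if "root u = root v"
    using 1(1)[of u] 1(2)[of v] that unfolding reachable_def by (simp add: rtranclp_trans)
qed

text \<open>One of two adjacent vertices is in \<open>S\<close> and has a single neighbour, but on a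
  cycle it would have two. The form with \<open>C\<close> covers the components of
  \<open>H\<close>.\<close>

lemma no_cycle:
  assumes "edges C \<subseteq> edges H"
  shows "\<not> is_cycle C xs"
proof
  assume c: "is_cycle C xs"
  then have len: "length xs \<ge> 3" and d: "distinct xs" by (auto simp: is_cycle_def)
  have pe: "{xs ! i, xs ! Suc i} \<in> edges H" if "Suc i < length xs" for i
    using c that assms by (auto simp: is_cycle_def path_edges_def)
  have e0: "{xs ! 0, xs ! 1} \<in> edges H" and e1: "{xs ! 1, xs ! 2} \<in> edges H"
    using pe[of 0] pe[of 1] len by (auto simp: numeral_2_eq_2)
  have e2: "{xs ! 0, xs ! (length xs - 1)} \<in> edges H"
    using c assms len by (auto simp: is_cycle_def hd_conv_nth last_conv_nth insert_commute
        simp flip: length_greater_0_conv)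
  have "xs ! 0 \<in> S \<or> xs ! 1 \<in> S" using e0 by (auto simp: edge_iff)
  then show False
  proof
    assume "xs ! 0 \<in> S"
    then have "xs ! 1 = xs ! (length xs - 1)" using e0 e2 by (simp add: edge_S)
    then show False using d len by (simp add: nth_eq_iff_index_eq)
  next
    assume "xs ! 1 \<in> S"
    then have "xs ! 0 = xs ! 2" using e0 e1 edge_S[of "xs ! 1"] by (simp add: insert_commute[of "xs ! 0"])
    then show False using d len by (subst (asm) nth_eq_iff_index_eq) auto
  qed
qed

text \<open>In each component only the centre can be a non-leaf, and a path on at most one vertex is
  left.\<close>

lemma caterpillar_forest: "caterpillar_forest H"
  unfolding caterpillar_forest_def
proof (intro conjI ballI)
  show "simple_graph H" by (rule simple)
  fix v assume v: "v \<in> verts H"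
  define R where "R = {u. reachable H v u}"
  define C where "C = induced H R"
  have R: "u \<in> R \<longleftrightarrow> root u = root v" for u by (auto simp: R_def reachable_root)
  have sC: "simple_graph C" using simple by (auto simp: simple_graph_def C_def induced_def)
  have eC: "{u, w} \<in> edges C \<longleftrightarrow> {u, w} \<in> edges H" if "u \<in> R" for u w
    using that root_edge[of u w] by (auto simp: C_def induced_def R)
  have reach: "reachable C u w" if "u \<in> R" "w \<in> R" for u w
  proof -
    have "reachable H u w" using that by (simp add: reachable_root R)
    then have "reachable C u w \<and> w \<in> R"
      unfolding reachable_def
    proof (induction rule: rtranclp_induct)
      case (step y z)
      then show ?case
        using eC[of y z] root_edge[of y z] by (auto simp: R intro: rtranclp.rtrancl_into_rtrancl)
    qed (use that in auto)
    then show ?thesis by simp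
  qed
  have tree: "tree C"
    unfolding tree_def connected_graph_def using sC reach v no_cycle[of C]
    by (auto simp: C_def induced_def R)
  define N where "N = {u \<in> verts C. \<not> leaf C u}"
  have "leaf C u" if u: "u \<in> S" "u \<in> verts C" for u
  proof -
    have uR: "u \<in> R" using u by (simp add: C_def induced_def)
    have "{e \<in> edges C. u \<in> e} = {{u, p u}}"
    proof -
      have "e = {u, p u}" if "e \<in> edges C" "u \<in> e" for e
      proof -
        have "e \<in> edges H" using that by (simp add: C_def induced_def)
        then obtain w where "w \<in> S" "e = {w, p w}" by (auto simp: H_def)
        then show ?thesis using that(2) u p_V by auto
      qed
      moreover have "{u, p u} \<in> edges C" using eC[OF uR] u by (simp add: edge_iff)
      ultimately show ?thesis by blast
    qed
    then show ?thesis using u by (simp add: leaf_def degree_def)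
  qed
  then have "N \<subseteq> {root v}" by (auto simp: N_def C_def induced_def R root_def)
  moreover have vN: "verts (induced C N) = N" by (auto simp: induced_def N_def)
  moreover have "edges (induced C N) = {}"
  proof -
    have "simple_graph (induced C N)" using sC by (auto simp: simple_graph_def induced_def)
    moreover have "card e \<le> 1" if "e \<subseteq> N" for e
      using card_mono[of "{root v}" e] that \<open>N \<subseteq> {root v}\<close> by auto
    ultimately have "e \<notin> edges (induced C N)" for e
      using vN unfolding simple_graph_def by (metis Suc_1 not_less_eq_eq order_refl)
    then show ?thesis by blast
  qed
  ultimately have "path_graph (induced C N)"
  proof -
    assume *: "N \<subseteq> {root v}" "edges (induced C N) = {}"
    \<comment> \<open>The set is empty when the centre has exactly one leaf: the component is then a
      single edge and both its ends are leaves.\<close>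
    from * consider "N = {}" | "N = {root v}" by auto
    then show ?thesis
    proof cases
      case 1
      show ?thesis unfolding path_graph_def
        by (rule exI[of _ "[]"]) (use 1 * vN in \<open>simp add: path_edges_def\<close>)
    next
      case 2
      show ?thesis unfolding path_graph_def
        by (rule exI[of _ "[root v]"]) (use 2 * vN in \<open>simp add: path_edges_def\<close>)
    qed
  qed
  then show "caterpillar (induced H {u. reachable H v u})"
    using tree by (simp add: caterpillar_def N_def C_def R_def)
qed

end

text \<open>The centre \<open>n\<close> gets the interval from \<open>n\<close> to \<open>n + 1/2\<close>; a leaf \<open>v\<close> gets the point at distance
  \<open>1 / (v + 2)\<close> from the left end of its centre's interval.\<close>

lemma star_forest_interval_graph:
  fixes V S :: "nat set"
  assumes "star_forest V S p"
  shows "interval_graph (star_forest.H V S p)"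
proof -
  interpret star_forest V S p by fact
  define I :: "nat \<Rightarrow> real set" where
    "I v = (if v \<in> S then {real (p v) + 1 / (real v + 2)} else {real v .. real v + 1/2})" for v
  have frac: "0 < 1 / (real v + 2)" "1 / (real v + 2) \<le> 1 / 2" for v
    by (auto simp: field_simps)
  \<comment> \<open>The offset is positive and at most 1/2, so the point stays in the interval of
    its own centre and reaches no other.\<close>
  have pt: "(real m + 1 / (real v + 2) \<in> {real n .. real n + 1/2}) \<longleftrightarrow> m = n" for m n v
  proof
    assume "real m + 1 / (real v + 2) \<in> {real n .. real n + 1/2}"
    then have "real n < real (Suc m)" "real m < real (Suc n)"
      using frac[of v] unfolding atLeastAtMost_iff of_nat_Suc by linarith+
    then show "m = n" by linarith
  qed (use frac[of v] in auto)
  have pp: "(real m + 1 / (real v + 2) = real n + 1 / (real w + 2)) \<longleftrightarrow> m = n \<and> v = w" for m n v w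
  proof
    assume e: "real m + 1 / (real v + 2) = real n + 1 / (real w + 2)"
    then have "m = n" using pt[of m v n] frac[of w] by auto
    with e show "m = n \<and> v = w" by (simp add: field_simps)
  qed auto
  have rr: "{real m .. real m + 1/2} \<inter> {real n .. real n + 1/2} = {}" if "m \<noteq> n" for m n
    using that by auto
  have "{u, v} \<in> edges H \<longleftrightarrow> I u \<inter> I v \<noteq> {}" if "u \<noteq> v" for u v
  proof (cases "u \<in> S"; cases "v \<in> S")
    assume "u \<in> S" "v \<in> S"
    then show ?thesis using that p_V by (auto simp: edge_iff I_def pp)
  next
    assume "u \<in> S" "v \<notin> S"
    then show ?thesis using pt[of "p u" u v] by (auto simp: edge_iff I_def)
  next
    assume "u \<notin> S" "v \<in> S"
    then show ?thesis using pt[of "p v" v u] by (auto simp: edge_iff I_def)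
  next
    assume "u \<notin> S" "v \<notin> S"
    then show ?thesis using rr[OF that] by (simp add: edge_iff I_def)
  qed
  moreover have "is_interval (I v)" "I v \<noteq> {}" for v by (auto simp: I_def is_interval_1)
  ultimately show ?thesis unfolding interval_graph_def
    by (intro conjI simple exI[of _ I] ballI impI) assumption+
qed

section \<open>Leaves at a small vertex set\<close>

text \<open>Pigeonhole: otherwise a choice of points would inject \<open>{..<L}\<close> into
  \<open>T\<close>. It later selects the pair of \<open>B\<close> vertices, the block of
  \<open>C\<close> vertices and the \<open>D\<close> vertex.\<close>

lemma disjoint_family_avoids:
  assumes "finite T" "card T < L"
    and disj: "\<And>m n. m < L \<Longrightarrow> n < L \<Longrightarrow> m \<noteq> n \<Longrightarrow> F m \<inter> F n = {}"
  obtains m :: nat where "m < L" "F m \<inter> T = {}"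
proof (rule ccontr)
  assume "\<not> thesis"
  then have "\<forall>m\<in>{..<L}. \<exists>t. t \<in> F m \<inter> T" using that by blast
  then obtain t where t: "\<And>m. m < L \<Longrightarrow> t m \<in> F m \<inter> T" unfolding bchoice_iff by auto
  have "inj_on t {..<L}"
    by (rule inj_onI) (use t disj in \<open>metis IntD1 IntI empty_iff lessThan_iff\<close>)
  moreover have "t ` {..<L} \<subseteq> T" using t by auto
  ultimately have "L \<le> card T" using card_inj_on_le[OF _ _ assms(1)] by fastforce
  then show False using assms(2) by simp
qed

text \<open>The exceptional vertices: a vertex outside this set is a leaf in every graph of the
  family that joins it to \<open>X\<close>.\<close>

definition inner_union :: "'a ugraph set \<Rightarrow> 'a set \<Rightarrow> 'a set" where
  "inner_union \<H> X = (\<Union>x\<in>X. \<Union>H\<in>\<H>. inner_nbrs H x)"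

lemma card_inner_union:
  assumes "finite \<H>" "finite X" "\<And>H. H \<in> \<H> \<Longrightarrow> few_inner H"
  shows "finite (inner_union \<H> X)" "card (inner_union \<H> X) \<le> 2 * card X * card \<H>"
proof -
  have fin: "finite (inner_nbrs H x)" "card (inner_nbrs H x) \<le> 2" if "H \<in> \<H>" for H x
    using assms(3)[OF that] by (auto simp: few_inner_def)
  show "finite (inner_union \<H> X)" using assms fin by (auto simp: inner_union_def)
  have *: "card (\<Union>H\<in>\<H>. inner_nbrs H x) \<le> card \<H> * 2" for x
    using card_UN_le[OF assms(1)] sum_bounded_above[of \<H> "\<lambda>H. card (inner_nbrs H x)" 2] fin
    by (force intro: order_trans)
  have "card (inner_union \<H> X) \<le> (\<Sum>x\<in>X. card (\<Union>H\<in>\<H>. inner_nbrs H x))"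
    unfolding inner_union_def by (rule card_UN_le[OF assms(2)])
  also have "\<dots> \<le> card X * (card \<H> * 2)" using sum_bounded_above[OF *] by simp
  finally show "card (inner_union \<H> X) \<le> 2 * card X * card \<H>" by (simp add: mult_ac)
qed

lemma not_inner_edge:
  "u \<notin> inner_nbrs H x \<Longrightarrow> {x, u} \<in> edges H \<Longrightarrow> {u, w} \<in> edges H \<Longrightarrow> w = x"
  by (auto simp: inner_nbrs_def)

text \<open>For non-exceptional \<open>u\<close> these graphs are spent: none of them can contain an
  edge from \<open>u\<close> to a vertex outside \<open>X\<close>.\<close>

definition used_by :: "'a ugraph set \<Rightarrow> 'a set \<Rightarrow> 'a \<Rightarrow> 'a ugraph set" where
  "used_by \<H> X u = {H \<in> \<H>. \<exists>x\<in>X. {x, u} \<in> edges H}"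

text \<open>Edges from \<open>u\<close> to different members of \<open>X\<close> lie in different
  graphs, since \<open>u\<close> is a leaf in each of them.\<close>

lemma card_used_by:
  assumes "finite \<H>" "finite X" "u \<notin> inner_union \<H> X"
    and cov: "\<And>x. x \<in> X \<Longrightarrow> \<exists>H\<in>\<H>. {x, u} \<in> edges H"
  shows "card X \<le> card (used_by \<H> X u)"
proof -
  obtain h where h: "\<And>x. x \<in> X \<Longrightarrow> h x \<in> \<H> \<and> {x, u} \<in> edges (h x)" using cov by metis
  have "inj_on h X"
  proof (rule inj_onI)
    fix x y assume xy: "x \<in> X" "y \<in> X" "h x = h y"
    have "u \<notin> inner_nbrs (h x) x" using assms(3) xy h by (auto simp: inner_union_def)
    from not_inner_edge[OF this, of y] show "x = y" using h xy by (metis insert_commute)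
  qed
  moreover have "h ` X \<subseteq> used_by \<H> X u" using h by (auto simp: used_by_def)
  moreover have "finite (used_by \<H> X u)" using assms(1) by (simp add: used_by_def)
  ultimately show ?thesis by (rule card_inj_on_le)
qed

lemma edge_avoids_used_by:
  assumes "u \<notin> inner_union \<H> X" "H \<in> used_by \<H> X u" "{u, w} \<in> edges H"
  shows "w \<in> X"
  using assms not_inner_edge unfolding used_by_def inner_union_def by fast

text \<open>At least \<open>card X\<close> of the at most \<open>card X + 1\<close> graphs are spent
  on the edges to \<open>X\<close>, so at most one is left for the others.\<close>

lemma unique_remaining_graph:
  assumes "finite \<H>" "finite X" "u \<notin> inner_union \<H> X" "card \<H> \<le> Suc (card X)"
    and cov: "\<And>x. x \<in> X \<Longrightarrow> \<exists>H\<in>\<H>. {x, u} \<in> edges H"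
    and "H \<in> \<H>" "H' \<in> \<H>" "{u, w} \<in> edges H" "{u, w'} \<in> edges H'" "w \<notin> X" "w' \<notin> X"
  shows "H = H'"
proof -
  have "used_by \<H> X u \<subseteq> \<H>" by (auto simp: used_by_def)
  then have "card (\<H> - used_by \<H> X u) \<le> 1"
    using card_used_by[OF assms(1-3) cov] assms(1,4)
    by (subst card_Diff_subset) (auto intro: finite_subset)
  moreover have "H \<in> \<H> - used_by \<H> X u" "H' \<in> \<H> - used_by \<H> X u"
    using assms edge_avoids_used_by by fast+
  ultimately show ?thesis using assms(1) card_le_Suc0_iff_eq[of "\<H> - used_by \<H> X u"] by auto
qed

section \<open>The graph\<close>

text \<open>Here \<open>q\<close> is \<open>k - 1\<close>. The vertices \<open>C i s\<close> start at \<open>s = q\<close> and come in five blocks of \<open>q\<close>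
  consecutive indices, the block of \<open>s\<close> being \<open>s div q\<close>. The edges of the graph join each vertex to
  its parents.\<close>

datatype vertex = A nat | B nat | C nat nat | D nat nat nat

instance vertex :: countable by countable_datatype

fun parents :: "nat \<Rightarrow> vertex \<Rightarrow> vertex set" where
  "parents q (A j) = {}"
| "parents q (B i) = A ` {..<q}"
| "parents q (C i s) = {B i, B (Suc i)}"
| "parents q (D i j r) = C i ` {j * q..<j * q + q}"

text \<open>The \<open>2 * L\<close> vertices \<open>B i\<close> contain \<open>L\<close> disjoint
  consecutive pairs, one of which avoids the exceptional vertices; the \<open>L\<close> vertices
  \<open>D i j r\<close> for fixed \<open>i\<close> and \<open>j\<close> serve the same purpose.
  Indices of \<open>C\<close> start at \<open>q\<close> so that the \<open>A\<close> vertices can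
  precede them in one sequence in the host tree.\<close>

definition vertices :: "nat \<Rightarrow> nat \<Rightarrow> vertex set" where
  "vertices q L = A ` {..<q} \<union> B ` {..<2 * L}
     \<union> {C i s | i s. Suc i < 2 * L \<and> q \<le> s \<and> s < 6 * q}
     \<union> {D i j r | i j r. Suc i < 2 * L \<and> 1 \<le> j \<and> j \<le> 5 \<and> r < L}"

lemma vertices_iff [simp]:
  "A j \<in> vertices q L \<longleftrightarrow> j < q"
  "B i \<in> vertices q L \<longleftrightarrow> i < 2 * L"
  "C i s \<in> vertices q L \<longleftrightarrow> Suc i < 2 * L \<and> q \<le> s \<and> s < 6 * q"
  "D i j r \<in> vertices q L \<longleftrightarrow> Suc i < 2 * L \<and> 1 \<le> j \<and> j \<le> 5 \<and> r < L"
  by (auto simp: vertices_def)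

lemma finite_vertices: "finite (vertices q L)"
proof (rule finite_subset)
  let ?S = "A ` {..<q} \<union> B ` {..<2 * L} \<union> case_prod C ` ({..<2 * L} \<times> {..<6 * q})
    \<union> (\<lambda>(i, j, r). D i j r) ` ({..<2 * L} \<times> {..5} \<times> {..<L})"
  show "finite ?S" by simp
  have "v \<in> ?S" if "v \<in> vertices q L" for v
    using that by (cases v) (auto simp: image_iff)
  then show "vertices q L \<subseteq> ?S" by blast
qed

lemma block_bounds:
  fixes q j s :: nat
  assumes "Suc 0 \<le> j" "j \<le> 5" "j * q \<le> s" "s < j * q + q"
  shows "q \<le> s" "s < 6 * q"
proof -
  have "1 * q \<le> j * q" "j * q \<le> 5 * q" using assms by (intro mult_right_mono; simp)+
  then show "q \<le> s" "s < 6 * q" using assms by linarith+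
qed

lemma block_disjoint:
  fixes q i j s :: nat
  assumes "i * q \<le> s" "s < i * q + q" "j * q \<le> s" "s < j * q + q"
  shows "i = j"
proof -
  have "s div q = i" "s div q = j" using assms by (auto intro!: div_nat_eqI simp: algebra_simps)
  then show ?thesis by simp
qed

lemma parents_vertices: "v \<in> vertices q L \<Longrightarrow> parents q v \<subseteq> vertices q L"
  by (cases v) (auto intro: block_bounds)

text \<open>Encoded by \<open>to_nat\<close> because \<open>stw\<close> is defined for graphs on
  natural numbers.\<close>

definition the_graph :: "nat \<Rightarrow> nat \<Rightarrow> nat ugraph" where
  "the_graph q L = \<lparr>verts = to_nat ` vertices q L,
     edges = {{to_nat v, to_nat u} | v u. v \<in> vertices q L \<and> u \<in> parents q v}\<rparr>"

lemma parents_neq: "u \<in> parents q v \<Longrightarrow> u \<noteq> v"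
  by (cases v) auto

lemma simple_the_graph: "simple_graph (the_graph q L)"
  using parents_vertices parents_neq finite_vertices
  by (fastforce simp: simple_graph_def the_graph_def card_2_iff)

lemma bipartite_the_graph: "bipartite (the_graph q L)"
  unfolding bipartite_def
proof (intro conjI exI)
  define side where "side v = (case v of A _ \<Rightarrow> True | C _ _ \<Rightarrow> True | _ \<Rightarrow> False)" for v
  let ?X = "to_nat ` {v \<in> vertices q L. side v}" and ?Y = "to_nat ` {v \<in> vertices q L. \<not> side v}"
  show "simple_graph (the_graph q L)" by (rule simple_the_graph)
  show "verts (the_graph q L) = ?X \<union> ?Y" by (auto simp: the_graph_def)
  show "?X \<inter> ?Y = {}" by auto
  show "\<forall>e\<in>edges (the_graph q L). \<exists>a\<in>?X. \<exists>b\<in>?Y. e = {a, b}"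
  proof
    fix e assume "e \<in> edges (the_graph q L)"
    then obtain v u where e: "e = {to_nat v, to_nat u}" "v \<in> vertices q L" "u \<in> parents q v"
      by (auto simp: the_graph_def)
    have "u \<in> vertices q L" using e parents_vertices by blast
    moreover have "side u \<noteq> side v" using e(3) by (cases v) (auto simp: side_def)
    ultimately show "\<exists>a\<in>?X. \<exists>b\<in>?Y. e = {a, b}"
      using e by (cases "side u") (auto simp: doubleton_eq_iff)
  qed
qed

section \<open>The lower bound\<close>

lemma cover_lower_bound:
  fixes \<H> :: "nat ugraph set"
  assumes q: "2 \<le> q" and L: "2 * q * Suc q < L"
    and fin: "finite \<H>" and few: "\<And>H. H \<in> \<H> \<Longrightarrow> few_inner H"
    and cover: "edges (the_graph q L) = (\<Union>H\<in>\<H>. edges H)"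
  shows "q + 2 \<le> card \<H>"
proof (rule ccontr)
  assume "\<not> q + 2 \<le> card \<H>"
  then have card: "card \<H> \<le> Suc q" by simp
  let ?f = "to_nat :: vertex \<Rightarrow> nat"
  have cov: "\<exists>H\<in>\<H>. {?f u, ?f v} \<in> edges H" if "v \<in> vertices q L" "u \<in> parents q v" for u v
  proof -
    have "{?f u, ?f v} \<in> edges (the_graph q L)"
      using that by (auto simp: the_graph_def insert_commute)
    then show ?thesis using cover by auto
  qed
  \<comment> \<open>Each of \<open>q\<close> vertices has at most two inner neighbours in each of at
    most \<open>q + 1\<close> graphs; this is the source of the bound on \<open>L\<close>.\<close>
  have avoid: "finite (inner_union \<H> X)" "card (inner_union \<H> X) < L" if "finite X" "card X = q" for X
  proof -
    have "card (inner_union \<H> X) \<le> 2 * q * card \<H>"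
      using card_inner_union(2)[OF fin that(1) few] that(2) by simp
    also have "\<dots> \<le> 2 * q * Suc q" using card by (intro mult_le_mono2)
    finally show "card (inner_union \<H> X) < L" using L by simp
    show "finite (inner_union \<H> X)" by (rule card_inner_union(1)[OF fin that(1) few])
  qed
  define As where "As = ?f ` A ` {..<q}"
  have As: "finite As" "card As = q" by (auto simp: As_def card_image inj_on_def)
  \<comment> \<open>Only pairs starting at an even index are used, as these are disjoint for
    different \<open>m\<close>.\<close>
  obtain m where m: "m < L" "{?f (B (2 * m)), ?f (B (Suc (2 * m)))} \<inter> inner_union \<H> As = {}"
  proof (rule disjoint_family_avoids[OF avoid[OF As]])
    show "{?f (B (2 * m)), ?f (B (Suc (2 * m)))} \<inter> {?f (B (2 * n)), ?f (B (Suc (2 * n)))} = {}"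
      if "m \<noteq> n" for m n
      using that double_not_eq_Suc_double[of m n] double_not_eq_Suc_double[of n m] by auto
  qed (rule that)
  define i where "i = 2 * m"
  define b where "b = ?f (B i)"
  define b' where "b' = ?f (B (Suc i))"
  define c where "c s = ?f (C i s)" for s
  have i: "Suc i < 2 * L" using m by (simp add: i_def)
  have bb: "b \<noteq> b'" "b \<notin> inner_union \<H> As" "b' \<notin> inner_union \<H> As"
    using m by (auto simp: b_def b'_def i_def)
  have cA: "c s \<notin> As" for s by (auto simp: c_def As_def)
  have covA: "\<exists>H\<in>\<H>. {x, b} \<in> edges H" "\<exists>H\<in>\<H>. {x, b'} \<in> edges H" if "x \<in> As" for x
    using that cov[of "B i"] cov[of "B (Suc i)"] i by (auto simp: As_def b_def b'_def)
  have covc: "\<exists>H\<in>\<H>. {b, c s} \<in> edges H" "\<exists>H\<in>\<H>. {b', c s} \<in> edges H" if "q \<le> s" "s < 6 * q" for s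
    using that cov[of "C i s"] i by (auto simp: c_def b_def b'_def)
  have q6: "q \<le> q" "q < 6 * q" using q by auto
  obtain X where X: "X \<in> \<H>" "{b, c q} \<in> edges X" using covc[OF q6] by blast
  obtain Y where Y: "Y \<in> \<H>" "{b', c q} \<in> edges Y" using covc[OF q6] by blast
  \<comment> \<open>The edges from \<open>b\<close> to \<open>As\<close> spend all graphs but one,
    so every edge from \<open>b\<close> to some \<open>c s\<close> lies in \<open>X\<close>;
    likewise for \<open>b'\<close> and \<open>Y\<close>.\<close>
  have cX: "{b, c s} \<in> edges X" and cY: "{b', c s} \<in> edges Y" if s: "q \<le> s" "s < 6 * q" for s
  proof -
    obtain H where H: "H \<in> \<H>" "{b, c s} \<in> edges H" using covc[OF s] by blast
    have "H = X"
      by (rule unique_remaining_graph[OF fin As(1) bb(2) _ covA(1) H(1) X(1) H(2) X(2) cA cA])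
        (use card As in auto)
    then show "{b, c s} \<in> edges X" using H by simp
    obtain H where H: "H \<in> \<H>" "{b', c s} \<in> edges H" using covc[OF s] by blast
    have "H = Y"
      by (rule unique_remaining_graph[OF fin As(1) bb(3) _ covA(2) H(1) Y(1) H(2) Y(2) cA cA])
        (use card As in auto)
    then show "{b', c s} \<in> edges Y" using H by simp
  qed
  note few' = few[unfolded few_inner_def, rule_format]
  \<comment> \<open>If the graphs were equal, each of the \<open>5 * q\<close> vertices
    \<open>c s\<close> would be an inner neighbour of \<open>b\<close>, by its edge to
    \<open>b'\<close>.\<close>
  have "X \<noteq> Y"
  proof
    assume "X = Y"
    then have "{b, c s} \<in> edges X \<and> b' \<noteq> b \<and> {c s, b'} \<in> edges X" if "q \<le> s" "s < 6 * q" for s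
      using cX[OF that] cY[OF that] bb(1) by (simp add: insert_commute)
    then have "c ` {q..<6 * q} \<subseteq> inner_nbrs X b"
      by (fastforce simp: inner_nbrs_def)
    then have "card (c ` {q..<6 * q}) \<le> 2"
      using few'[OF X(1), of b] by (meson card_mono le_trans)
    moreover have "inj c" by (auto simp: c_def inj_def)
    ultimately show False using q by (simp add: card_image inj_on_subset)
  qed
  define T where "T = inner_nbrs X b \<union> inner_nbrs Y b'"
  \<comment> \<open>At most two inner neighbours in each of \<open>X\<close> and \<open>Y\<close>
    give at most four, hence the choice of five blocks.\<close>
  have T: "finite T" "card T < 5"
    using few'[OF X(1), of b] few'[OF Y(1), of b'] card_Un_le[of "inner_nbrs X b" "inner_nbrs Y b'"]
    by (auto simp: T_def)
  obtain j' where j': "j' < 5" "c ` {Suc j' * q..<Suc j' * q + q} \<inter> T = {}"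
  proof (rule disjoint_family_avoids[OF T])
    show "c ` {Suc m * q..<Suc m * q + q} \<inter> c ` {Suc n * q..<Suc n * q + q} = {}"
      if "m \<noteq> n" for m n
      using that block_disjoint[of "Suc m" q _ "Suc n"] by (auto simp: c_def simp del: mult_Suc)
  qed (rule that)
  define j where "j = Suc j'"
  define Cs where "Cs = c ` {j * q..<j * q + q}"
  have Cs: "finite Cs" "card Cs = q" by (auto simp: Cs_def card_image inj_on_def c_def)
  obtain r where r: "r < L" "{?f (D i j r)} \<inter> inner_union \<H> Cs = {}"
    by (rule disjoint_family_avoids[OF avoid[OF Cs], of "\<lambda>r. {?f (D i j r)}"]) (simp, rule that)
  define d where "d = ?f (D i j r)"
  have d: "d \<notin> inner_union \<H> Cs" "d \<noteq> b" "d \<noteq> b'" using r by (auto simp: d_def b_def b'_def)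
  have "\<exists>H\<in>\<H>. {x, d} \<in> edges H" if "x \<in> Cs" for x
    using that cov[of "D i j r"] i r j' by (auto simp: Cs_def d_def c_def j_def)
  from card_used_by[OF fin Cs(1) d(1) this] have "q \<le> card (used_by \<H> Cs d)" by (simp add: Cs)
  \<comment> \<open>A vertex \<open>c s\<close> outside \<open>T\<close> is a leaf at
    \<open>b\<close> in \<open>X\<close> and a leaf at \<open>b'\<close> in \<open>Y\<close>, so its
    edge to \<open>d\<close> lies in neither.\<close>
  also have "used_by \<H> Cs d \<subseteq> \<H> - {X, Y}"
  proof
    fix H assume "H \<in> used_by \<H> Cs d"
    then obtain s where H: "H \<in> \<H>" "{c s, d} \<in> edges H" and s: "j * q \<le> s" "s < j * q + q"
      by (auto simp: used_by_def Cs_def)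
    have s6: "q \<le> s" "s < 6 * q" using block_bounds[of j q s] s j' by (auto simp: j_def)
    have "c s \<in> c ` {Suc j' * q..<Suc j' * q + q}" using s unfolding j_def by simp
    then have "c s \<notin> T" using j'(2) by blast
    then have "H \<noteq> X" "H \<noteq> Y"
      using not_inner_edge[OF _ cX[OF s6]] not_inner_edge[OF _ cY[OF s6]] H d by (auto simp: T_def)
    then show "H \<in> \<H> - {X, Y}" using H by simp
  qed
  then have "card (used_by \<H> Cs d) \<le> card (\<H> - {X, Y})" using fin by (intro card_mono) auto
  also have "\<dots> = card \<H> - 2" using X Y \<open>X \<noteq> Y\<close> by (subst card_Diff_subset) auto
  finally show False using card q by simp
qed

section \<open>The upper bound\<close>

text \<open>The star centres of colour \<open>x\<close> are the vertices of colour \<open>x\<close>. The parents of a vertex have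
  distinct colours, and a parent of a parent never has the parent's colour, so the edges from
  vertices to their parents of colour \<open>x\<close> form a star forest. The value at \<open>D i j r\<close> is irrelevant,
  since these vertices are nobody's parents.\<close>

fun colour :: "nat \<Rightarrow> vertex \<Rightarrow> nat" where
  "colour q (A j) = j"
| "colour q (B i) = q + i mod 2"
| "colour q (C i s) = s mod q"
| "colour q (D i j r) = q"

text \<open>Consecutive \<open>B\<close> indices differ in parity, and a block of \<open>q\<close>
  consecutive indices meets each residue modulo \<open>q\<close> once.\<close>

lemma inj_on_colour_parents: "inj_on (colour q) (parents q v)"
proof (cases v)
  case (D i j r)
  have "s = t" if "j * q \<le> s" "s < j * q + q" "j * q \<le> t" "t < j * q + q" "s mod q = t mod q" for s t
  proof -
    have "s div q = j" "t div q = j" using that by (auto intro!: div_nat_eqI simp: algebra_simps)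
    then show ?thesis using that(5) by (metis div_mult_mod_eq)
  qed
  then show ?thesis using D by (auto simp: inj_on_def)
qed (auto simp: inj_on_def, presburger+)

text \<open>Among parents, \<open>A\<close> and \<open>C\<close> have colours below
  \<open>q\<close>, and \<open>B\<close> has one of the two colours from \<open>q\<close> on.
  Passing from a parent to its own parents switches between these ranges.\<close>

lemma colour_parents:
  assumes "2 \<le> q" "u \<in> parents q v"
  shows "colour q u < q + 2" "w \<in> parents q u \<Longrightarrow> colour q w \<noteq> colour q u"
proof -
  have mod: "s mod q < q" for s using assms(1) by simp
  show "colour q u < q + 2"
    using assms(2) mod by (cases v) (auto simp: less_Suc_eq)
  show "colour q w \<noteq> colour q u" if "w \<in> parents q u"
  proof (cases v)
    case (D i j r)
    then obtain s where "u = C i s" using assms(2) by auto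
    then have "colour q u < q" "q \<le> colour q w" using that mod by auto
    then show ?thesis by simp
  qed (use assms(2) that in auto)
qed

lemma star_forest_cover:
  assumes q: "2 \<le> q"
  obtains \<H> where "finite \<H>" "card \<H> \<le> q + 2"
    "\<forall>H\<in>\<H>. subgraph H (the_graph q L) \<and> caterpillar_forest H \<and> interval_graph H"
    "edges (the_graph q L) = (\<Union>H\<in>\<H>. edges H)"
proof -
  define W where "W x = {v \<in> vertices q L. \<exists>u\<in>parents q v. colour q u = x}" for x
  \<comment> \<open>For \<open>v\<close> in \<open>W x\<close> the description is unique, by
    injectivity of \<open>colour\<close> on the parents of \<open>v\<close>.\<close>
  define par where "par x v = (THE u. u \<in> parents q v \<and> colour q u = x)" for x v
  have par: "par x v = u" if "u \<in> parents q v" "colour q u = x" for x u v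
    unfolding par_def using that inj_on_colour_parents[of q v] by (auto simp: inj_on_def)
  have par': "par x v \<in> parents q v" "colour q (par x v) = x" "par x v \<in> vertices q L" "par x v \<notin> W x"
    if v: "v \<in> W x" for x v
  proof -
    obtain u where u: "v \<in> vertices q L" "u \<in> parents q v" "colour q u = x"
      using v by (auto simp: W_def)
    show "par x v \<in> parents q v" "colour q (par x v) = x" "par x v \<in> vertices q L" "par x v \<notin> W x"
      using u par[OF u(2,3)] parents_vertices[OF u(1)] colour_parents(2)[OF q u(2)]
      by (auto simp: W_def)
  qed
  let ?V = "to_nat ` vertices q L" and ?S = "\<lambda>x. to_nat ` W x"
    and ?p = "\<lambda>x n. to_nat (par x (from_nat n))"
  define SF where "SF x = star_forest.H ?V (?S x) (?p x)" for x
  have WV: "W x \<subseteq> vertices q L" for x by (auto simp: W_def)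
  have sf: "star_forest ?V (?S x) (?p x)" for x
    by unfold_locales (use par' finite_vertices WV[THEN subsetD] in auto)
  have eSF: "edges (SF x) = {{to_nat v, to_nat (par x v)} | v. v \<in> W x}"
    and vSF: "verts (SF x) = ?V" for x
    by (auto simp: SF_def star_forest.H_def[OF sf])
  have sub: "edges (SF x) \<subseteq> edges (the_graph q L)" for x
    unfolding eSF the_graph_def using par'(1) WV by fastforce
  show ?thesis
  proof (rule that)
    show "finite (SF ` {..<q + 2})" by simp
    show "card (SF ` {..<q + 2}) \<le> q + 2" using card_image_le[of "{..<q + 2}" SF] by simp
    show "\<forall>H\<in>SF ` {..<q + 2}. subgraph H (the_graph q L) \<and> caterpillar_forest H \<and> interval_graph H"
    proof
      fix H assume "H \<in> SF ` {..<q + 2}"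
      then obtain x where H: "H = SF x" by auto
      show "subgraph H (the_graph q L) \<and> caterpillar_forest H \<and> interval_graph H"
        using star_forest.caterpillar_forest[OF sf] star_forest_interval_graph[OF sf]
          star_forest.simple[OF sf] simple_the_graph sub vSF
        by (auto simp: H subgraph_def SF_def the_graph_def)
    qed
    have "e \<in> (\<Union>H\<in>SF ` {..<q + 2}. edges H)" if "e \<in> edges (the_graph q L)" for e
    proof -
      obtain v u where e: "e = {to_nat v, to_nat u}" "v \<in> vertices q L" "u \<in> parents q v"
        using \<open>e \<in> edges (the_graph q L)\<close> by (auto simp: the_graph_def)
      have "e \<in> edges (SF (colour q u))" using e par[OF e(3)] by (auto simp: eSF W_def)
      then show ?thesis using colour_parents(1)[OF q e(3)] by auto
    qed
    then show "edges (the_graph q L) = (\<Union>H\<in>SF ` {..<q + 2}. edges H)" using sub by blast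
  qed
qed

text \<open>Stated for a property \<open>P\<close> lying between being a star forest and
  \<open>few_inner\<close>, so that it applies to both invariants.\<close>

lemma cover_number_the_graph:
  assumes q: "2 \<le> q" and L: "2 * q * Suc q < L"
    and few: "\<And>H. P H \<Longrightarrow> subgraph H (the_graph q L) \<Longrightarrow> few_inner H"
    and star: "\<And>H. caterpillar_forest H \<Longrightarrow> interval_graph H \<Longrightarrow> P H"
  shows "cover_number P (the_graph q L) = q + 2"
proof -
  let ?cov = "\<lambda>n. \<exists>\<H>. finite \<H> \<and> card \<H> = n \<and> (\<forall>H\<in>\<H>. P H \<and> subgraph H (the_graph q L)) \<and>
    edges (the_graph q L) = (\<Union>H\<in>\<H>. edges H)"
  have lower: "q + 2 \<le> n" if "?cov n" for n
    using that cover_lower_bound[OF q L] few by metis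
  obtain \<H> where \<H>: "finite \<H>" "card \<H> \<le> q + 2"
    "\<forall>H\<in>\<H>. subgraph H (the_graph q L) \<and> caterpillar_forest H \<and> interval_graph H"
    "edges (the_graph q L) = (\<Union>H\<in>\<H>. edges H)"
    by (rule star_forest_cover[OF q])
  then have cov: "?cov (card \<H>)" using star by blast
  \<comment> \<open>The star forests form a set of at most \<open>q + 2\<close> graphs; that none
    coincide follows from the lower bound.\<close>
  then have "card \<H> = q + 2" using \<H>(2) lower by (meson le_antisym)
  with cov have "?cov (q + 2)" by simp
  then show ?thesis unfolding cover_number_def by (rule Least_equality) (rule lower)
qed

section \<open>The host tree\<close>

text \<open>A k-tree prescribed by the set \<open>Q v\<close> onto which each \<open>v\<close>
  outside the base is added. The rank yields an order of construction, the condition on pairs makes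
  \<open>Q v\<close> a clique, and injectivity of \<open>Q\<close> forbids using a clique twice. The
  induction removes a vertex of maximal rank.\<close>

lemma simple_ktree_constr_by_rank:
  fixes f :: "'a \<Rightarrow> 'b" and rank :: "'a \<Rightarrow> nat"
  assumes "inj f" "finite V" "K \<subseteq> V" "card K = k + 1"
    and "\<And>v. v \<in> V - K \<Longrightarrow> Q v \<subseteq> V \<and> card (Q v) = k"
    and "\<And>u v. \<lbrakk>v \<in> V - K; u \<in> Q v\<rbrakk> \<Longrightarrow> u \<in> K \<or> rank u < rank v"
    and "\<And>v u w. \<lbrakk>v \<in> V - K; u \<in> Q v; w \<in> Q v; u \<noteq> w\<rbrakk> \<Longrightarrow>
      {u, w} \<subseteq> K \<or> (u \<notin> K \<and> w \<in> Q u) \<or> (w \<notin> K \<and> u \<in> Q w)"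
    and "inj_on Q (V - K)"
  shows "simple_ktree_constr k
    \<lparr>verts = f ` V, edges = {{f u, f w} | u w. u \<in> V \<and> w \<in> V \<and> u \<noteq> w \<and>
       ({u, w} \<subseteq> K \<or> (w \<notin> K \<and> u \<in> Q w))}\<rparr> ((\<lambda>v. f ` Q v) ` (V - K))"
  using assms(2-)
proof (induction "card V" arbitrary: V rule: less_induct)
  case less
  note prems = less.prems
  let ?E = "\<lambda>V. {{f u, f w} | u w. u \<in> V \<and> w \<in> V \<and> u \<noteq> w \<and> ({u, w} \<subseteq> K \<or> (w \<notin> K \<and> u \<in> Q w))}"
  show ?case
  proof (cases "V = K")
    case True
    have "?E K = {e. e \<subseteq> f ` K \<and> card e = 2}"
      using assms(1) by (fastforce simp: card_2_iff inj_eq)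
    then have "\<lparr>verts = f ` V, edges = ?E V\<rparr> = complete_graph (f ` K)"
      by (simp add: complete_graph_def True)
    moreover have "card (f ` K) = k + 1"
      using prems(3) assms(1) by (simp add: card_image inj_on_subset)
    moreover have "finite (f ` K)" using prems(1,2) by (auto intro: finite_subset)
    ultimately show ?thesis using simple_ktree_constr.start[of "f ` K" k] by (simp add: True)
  next
    case False
    have "finite (rank ` (V - K))" "rank ` (V - K) \<noteq> {}" using prems(1,2) False by auto
    from Max_in[OF this] obtain v where v: "v \<in> V - K" "rank v = Max (rank ` (V - K))" by auto
    have vmax: "rank u \<le> rank v" if "u \<in> V - K" for u
      using that v prems(1) by (auto intro: Max_ge)
    have notin: "v \<notin> Q u" if "u \<in> V - K" for u
      using prems(5)[OF that, of v] vmax[OF that] v by fastforce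
    let ?W = "V - {v}"
    let ?G = "\<lparr>verts = f ` ?W, edges = ?E ?W\<rparr>"
    have IH: "simple_ktree_constr k ?G ((\<lambda>v. f ` Q v) ` (?W - K))"
    proof (rule less.hyps)
      show "card ?W < card V" using v prems(1) by (meson DiffD1 card_Diff1_less)
      show "Q u \<subseteq> ?W \<and> card (Q u) = k" if "u \<in> ?W - K" for u
        using prems(4)[of u] notin[of u] that by auto
      show "inj_on Q (?W - K)" using prems(7) by (rule inj_on_subset) auto
      show "finite ?W" "K \<subseteq> ?W" "card K = k + 1" using prems(1-3) v by auto
      show "u \<in> K \<or> rank u < rank x" if "x \<in> ?W - K" "u \<in> Q x" for u x
        using prems(5)[of x u] that by simp
      show "{u, w} \<subseteq> K \<or> (u \<notin> K \<and> w \<in> Q u) \<or> (w \<notin> K \<and> u \<in> Q w)"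
        if "x \<in> ?W - K" "u \<in> Q x" "w \<in> Q x" "u \<noteq> w" for x u w
        using prems(6)[of x u w] that by simp
    qed
    have Qv: "Q v \<subseteq> ?W" "card (Q v) = k" using prems(4)[OF v(1)] notin[OF v(1)] by auto
    have "simple_ktree_constr k
       \<lparr>verts = insert (f v) (verts ?G), edges = edges ?G \<union> {{f v, u} | u. u \<in> f ` Q v}\<rparr>
       (insert (f ` Q v) ((\<lambda>v. f ` Q v) ` (?W - K)))"
    proof (rule simple_ktree_constr.add[OF IH])
      \<comment> \<open>Either both vertices are in the base, or one was added onto a set containing
        the other.\<close>
      have "{f u, f w} \<in> ?E ?W" if "u \<in> Q v" "w \<in> Q v" "f u \<noteq> f w" for u w
      proof -
        have "u \<noteq> w" using that by auto
        from prems(6)[OF v(1) that(1,2) this]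
        consider "{u, w} \<subseteq> K \<or> (w \<notin> K \<and> u \<in> Q w)" | "u \<notin> K \<and> w \<in> Q u" by blast
        then show ?thesis
        proof cases
          case 1 then show ?thesis using that Qv \<open>u \<noteq> w\<close> by blast
        next
          case 2
          then have "{f w, f u} \<in> ?E ?W" using that Qv \<open>u \<noteq> w\<close> by blast
          then show ?thesis by (simp only: insert_commute)
        qed
      qed
      then show "clique ?G (f ` Q v)" using Qv unfolding clique_def by auto
      show "card (f ` Q v) = k" using Qv assms(1) by (simp add: card_image inj_on_subset)
      show "f ` Q v \<notin> (\<lambda>v. f ` Q v) ` (?W - K)"
      proof
        assume "f ` Q v \<in> (\<lambda>v. f ` Q v) ` (?W - K)"
        then obtain u where u: "u \<in> ?W - K" "f ` Q v = f ` Q u" by auto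
        then have "Q v = Q u" using assms(1) by (simp add: inj_image_eq_iff)
        then show False using u v prems(7) by (auto dest: inj_onD)
      qed
      show "f v \<notin> verts ?G" using assms(1) by (auto simp: inj_eq)
    qed
    moreover have "insert (f v) (verts ?G) = f ` V" using v by auto
    moreover have "edges ?G \<union> {{f v, u} | u. u \<in> f ` Q v} = ?E V"
    proof -
      have sub: "?E ?W \<subseteq> ?E V" by blast
      have "e \<in> ?E ?W \<union> {{f v, u} | u. u \<in> f ` Q v}" if "e \<in> ?E V" for e
      proof -
        obtain u w where uw: "e = {f u, f w}" "u \<in> V" "w \<in> V" "u \<noteq> w"
          "{u, w} \<subseteq> K \<or> (w \<notin> K \<and> u \<in> Q w)" using \<open>e \<in> ?E V\<close> by blast
        have "u \<noteq> v" using uw notin[of w] v by auto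
        show ?thesis
        proof (cases "w = v")
          case True
          then have "u \<in> Q v" using uw(5) v by simp
          then have "{f v, f u} \<in> {{f v, u} | u. u \<in> f ` Q v}" by blast
          then show ?thesis using uw(1) True by (simp add: insert_commute)
        next
          case False
          then have "e \<in> ?E ?W" using uw \<open>u \<noteq> v\<close> by blast
          then show ?thesis by (rule UnI1)
        qed
      qed
      then have sup: "?E V \<subseteq> ?E ?W \<union> {{f v, u} | u. u \<in> f ` Q v}" by (rule subsetI)
      have "{f v, f u} \<in> ?E V" if "u \<in> Q v" for u
      proof -
        have "{f u, f v} \<in> ?E V" using that Qv v by blast
        then show ?thesis by (simp only: insert_commute)
      qed
      then have "{{f v, u} | u. u \<in> f ` Q v} \<subseteq> ?E V" by blast
      then show ?thesis unfolding ugraph.simps by (rule equalityI[OF Un_least[OF sub] sup])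
    qed
    moreover have "insert (f ` Q v) ((\<lambda>v. f ` Q v) ` (?W - K)) = (\<lambda>v. f ` Q v) ` (V - K)"
      using v by auto
    ultimately show ?thesis by simp
  qed
qed

text \<open>The host: \<open>B i\<close> is added onto \<open>B (i - 1)\<close> and all \<open>A j\<close>; for fixed \<open>i\<close> the sequence
  \<open>A 0, \<dots>, A (q - 1), C i q, C i (q + 1), \<dots>\<close> (that is, \<open>C' q i\<close>) is a path power, each
  new member being added onto \<open>B i\<close>, \<open>B (i + 1)\<close> and its \<open>q - 1\<close> predecessors; the \<open>D i j r\<close> are
  added one after another onto a block of \<open>q\<close> consecutive members and \<open>D i j (r - 1)\<close> (the
  first one onto the block and \<open>B i\<close>), which makes the cliques distinct.\<close>

definition C' :: "nat \<Rightarrow> nat \<Rightarrow> nat \<Rightarrow> vertex" where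
  "C' q i s = (if s < q then A s else C i s)"

fun hood :: "nat \<Rightarrow> vertex \<Rightarrow> vertex set" where
  "hood q (A j) = {}"
| "hood q (B i) = insert (B (i - 1)) (A ` {..<q})"
| "hood q (C i s) = {B i, B (Suc i)} \<union> C' q i ` {Suc s - q..<s}"
| "hood q (D i j r) = insert (if r = 0 then B i else D i j (r - 1)) (C i ` {j * q..<j * q + q})"

text \<open>A starting clique of \<open>q + 2\<close> vertices, as the host is a simple k-tree for
  \<open>k = q + 1\<close>.\<close>

definition base :: "nat \<Rightarrow> vertex set" where
  "base q = A ` {..<q} \<union> {B 0, B 1}"

text \<open>The offsets put all \<open>B\<close> vertices of the graph below all \<open>C\<close>
  vertices, and these below all \<open>D\<close> vertices.\<close>

fun rank :: "nat \<Rightarrow> nat \<Rightarrow> vertex \<Rightarrow> nat" where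
  "rank q L (A j) = 0"
| "rank q L (B i) = Suc i"
| "rank q L (C i s) = 2 * L + s"
| "rank q L (D i j r) = 2 * L + 6 * q + r"

lemma inj_C': "inj (C' q i)"
  by (auto simp: inj_def C'_def split: if_splits)

lemma C'_neq [simp]: "C' q i s \<noteq> B t" "B t \<noteq> C' q i s" "C' q i s \<noteq> D a b c"
  by (auto simp: C'_def)

lemma card_hood:
  assumes "2 \<le> q" "v \<in> vertices q L - base q"
  shows "card (hood q v) = q + 1"
proof (cases v)
  case (C i s)
  have "card (C' q i ` {Suc s - q..<s}) = q - 1"
    using assms C by (subst card_image) (auto intro: inj_on_subset[OF inj_C'])
  then show ?thesis using assms(1) C by (simp add: card_insert_if image_iff)
next
  case (D i j r)
  then show ?thesis by (auto simp: card_image inj_on_def image_iff)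
qed (use assms in \<open>auto simp: base_def card_image inj_on_def image_iff\<close>)

lemma hood_vertices:
  assumes "2 \<le> q" "v \<in> vertices q L - base q"
  shows "hood q v \<subseteq> vertices q L"
  using assms by (cases v) (auto simp: base_def C'_def intro: block_bounds)

lemma rank_hood:
  assumes "2 \<le> q" "v \<in> vertices q L - base q" "u \<in> hood q v"
  shows "u \<in> base q \<or> rank q L u < rank q L v"
proof (cases v)
  case (D i j r)
  then have "s < 6 * q" if "j * q \<le> s" "s < j * q + q" for s
    using assms(2) that block_bounds(2)[of j q s] by simp
  then show ?thesis using assms D by (fastforce split: if_splits)
qed (use assms in \<open>auto simp: base_def C'_def\<close>)

text \<open>Every pair in a hood is of one of a few kinds, checked for the symmetric relation
  \<open>adj\<close>; members of one sequence \<open>C' q i\<close> are adjacent when their indices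
  differ by less than \<open>q\<close>.\<close>

lemma clique_hood:
  assumes q: "2 \<le> q" and v: "v \<in> vertices q L - base q"
    and uw: "u \<in> hood q v" "w \<in> hood q v" "u \<noteq> w"
  shows "{u, w} \<subseteq> base q \<or> (u \<notin> base q \<and> w \<in> hood q u) \<or> (w \<notin> base q \<and> u \<in> hood q w)"
proof -
  define adj where "adj u w \<longleftrightarrow> {u, w} \<subseteq> base q \<or> (u \<notin> base q \<and> w \<in> hood q u) \<or> (w \<notin> base q \<and> u \<in> hood q w)"
    for u w
  have sym: "adj u w \<longleftrightarrow> adj w u" for u w by (auto simp: adj_def)
  have AA: "adj (A s) (A t)" if "s < q" "t < q" for s t using that by (auto simp: adj_def base_def)
  have AB: "adj (A s) (B i)" if "s < q" for s i
    using that by (cases "i \<le> 1") (auto simp: adj_def base_def le_Suc_eq)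
  have BB: "adj (B i) (B (Suc i))" for i by (cases i) (auto simp: adj_def base_def)
  have BC: "adj (B i) (C i s)" "adj (B (Suc i)) (C i s)" for i s
    by (auto simp: adj_def base_def)
  have BC': "adj (B i) (C' q i s)" "adj (B (Suc i)) (C' q i s)" for i s
    using BC AB sym by (auto simp: C'_def)
  \<comment> \<open>Unless both members are \<open>A\<close> vertices of the base, the later one is
    some \<open>C i t\<close> and the earlier one is in its window of \<open>q - 1\<close>
    predecessors.\<close>
  have CC': "adj (C' q i s) (C' q i t)" if "s < t" "t < s + q" for i s t
  proof (cases "t < q")
    case True then show ?thesis using that AA by (auto simp: C'_def)
  next
    case False
    then have "C' q i s \<in> hood q (C i t)" using that by auto
    then show ?thesis using False by (auto simp: adj_def C'_def base_def)
  qed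
  have CC'': "adj (C' q i s) (C' q i t)" if "s \<noteq> t" "t < s + q" "s < t + q" for i s t
    using CC'[of s t i] CC'[of t s i] that sym by (cases "s < t") auto
  have CD: "adj (C i s) (D i j r)" if "j * q \<le> s" "s < j * q + q" for i j r s
    using that by (auto simp: adj_def base_def)
  have "adj u w"
  proof (cases v)
    case (A j) then show ?thesis using v by (auto simp: base_def)
  next
    case (B i)
    then show ?thesis using uw AA AB sym by auto
  next
    case (C i s)
    have "C' q i t \<noteq> C' q i t' \<Longrightarrow> t \<in> {Suc s - q..<s} \<Longrightarrow> t' \<in> {Suc s - q..<s} \<Longrightarrow>
      adj (C' q i t) (C' q i t')" for t t'
      by (rule CC'') auto
    then show ?thesis using uw C BB BC' sym by auto
  next
    case (D i j r)
    then have j: "Suc 0 \<le> j" "j \<le> 5" using v by auto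
    have C: "C i t = C' q i t" if "j * q \<le> t" "t < j * q + q" for t
      using block_bounds[OF j that] by (simp add: C'_def)
    define S where "S = C i ` {j * q..<j * q + q}"
    define e where "e = (if r = 0 then B i else D i j (r - 1))"
    have SS: "adj x y" if "x \<in> S" "y \<in> S" "x \<noteq> y" for x y
    proof -
      from \<open>x \<in> S\<close> \<open>y \<in> S\<close> obtain t t' where "x = C i t" "y = C i t'"
        "t \<in> {j * q..<j * q + q}" "t' \<in> {j * q..<j * q + q}" by (auto simp: S_def)
      then show ?thesis using CC''[of t t' i] C \<open>x \<noteq> y\<close> by auto
    qed
    have Se: "adj x e" if "x \<in> S" for x
      using that BC CD sym by (auto simp: S_def e_def)
    have eS: "adj e x" if "x \<in> S" for x
      by (rule sym[THEN iffD1, OF Se[OF that]])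
    have "hood q v = insert e S" by (simp add: D S_def e_def)
    then have "u = e \<or> u \<in> S" "w = e \<or> w \<in> S" using uw by auto
    then show ?thesis by (elim disjE) (use uw(3) SS Se eS in auto)
  qed
  then show ?thesis by (simp add: adj_def)
qed

text \<open>The kind of a vertex is read off its hood: a \<open>C\<close> hood contains two
  \<open>B\<close> vertices and the other hoods at most one, while \<open>A 0\<close> separates
  \<open>B\<close> hoods from \<open>D\<close> hoods.\<close>

lemma inj_on_hood:
  assumes q: "2 \<le> q"
  shows "inj_on (hood q) (vertices q L - base q)"
proof (rule inj_onI)
  fix v w assume v: "v \<in> vertices q L - base q" and w: "w \<in> vertices q L - base q"
    and eq: "hood q v = hood q w"
  have Bs: "{n. B n \<in> hood q (B i)} = {i - 1}" "{n. B n \<in> hood q (C i s)} = {i, Suc i}"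
    "{n. B n \<in> hood q (D i j r)} = (if r = 0 then {i} else {})" for i s j r
    by (auto simp: image_iff)
  have eqB: "{n. B n \<in> hood q v} = {n. B n \<in> hood q w}" by (simp add: eq)
  have eqA: "A 0 \<in> hood q v \<longleftrightarrow> A 0 \<in> hood q w" by (simp add: eq)
  have eqC: "{(i, s). C i s \<in> hood q v} = {(i, s). C i s \<in> hood q w}" by (simp add: eq)
  have eqD: "{r. \<exists>i j. D i j r \<in> hood q v} = {r. \<exists>i j. D i j r \<in> hood q w}" by (simp add: eq)
  show "v = w"
  proof (cases v; cases w)
    fix i i' assume vw: "v = B i" "w = B i'"
    \<comment> \<open>Truncated subtraction gives \<open>B 0\<close> and \<open>B 1\<close> the same
      hood, but both lie in the base.\<close>
    then show ?thesis using eqB v w unfolding vw Bs by (cases i; cases i'; auto simp: base_def)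
  next
    fix i s i' s' assume vw: "v = C i s" "w = C i' s'"
    have i: "i = i'" using eqB unfolding vw Bs by (auto simp: doubleton_eq_iff)
    have "C' q i t \<in> hood q (C i s) \<longleftrightarrow> t \<in> {Suc s - q..<s}" for t s
      by (auto simp: inj_image_mem_iff[OF inj_C'])
    then have "{Suc s - q..<s} = {Suc s' - q..<s'}" using eq unfolding vw i by blast
    \<comment> \<open>As \<open>q\<close> is at least 2, the windows are nonempty, so the right end
      determines \<open>s\<close>.\<close>
    moreover have "Suc s - q < s" "Suc s' - q < s'" using q v w vw by auto
    ultimately show ?thesis using vw i by (simp add: atLeastLessThan_inj)
  next
    fix i j r i' j' r' assume vw: "v = D i j r" "w = D i' j' r'"
    \<comment> \<open>The least index of the block is \<open>j * q\<close>; comparing it both ways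
      gives \<open>j\<close>. The preceding \<open>D\<close> vertex, if any, then gives
      \<open>r\<close>.\<close>
    have "(i, j * q) \<in> {(i, s). C i s \<in> hood q v}" using q by (auto simp: vw)
    then have i: "i = i'" "j' * q \<le> j * q" unfolding eqC by (auto simp: vw split: if_splits)
    have "(i', j' * q) \<in> {(i, s). C i s \<in> hood q w}" using q by (auto simp: vw)
    then have "j * q \<le> j' * q" unfolding eqC[symmetric] by (auto simp: vw split: if_splits)
    then have j: "j = j'" using i q by simp
    have Ds: "{r. \<exists>i j. D i j r \<in> hood q (D i' j' r')} = (if r' = 0 then {} else {r' - 1})" for i' j' r'
      by auto
    have "r = r'" using eqD unfolding vw Ds by (auto split: if_splits)
    then show ?thesis using vw i j by simp
  next
    fix i i' s' assume vw: "v = B i" "w = C i' s'"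
    show ?thesis using eqB unfolding vw Bs by auto
  next
    fix i i' s' assume vw: "v = C i' s'" "w = B i"
    show ?thesis using eqB unfolding vw Bs by auto
  next
    fix i i' j' r' assume vw: "v = B i" "w = D i' j' r'"
    show ?thesis using eqA q by (auto simp: vw split: if_splits)
  next
    fix i i' j' r' assume vw: "v = D i' j' r'" "w = B i"
    show ?thesis using eqA q by (auto simp: vw split: if_splits)
  next
    fix i s i' j' r' assume vw: "v = C i s" "w = D i' j' r'"
    show ?thesis using eqB unfolding vw Bs by (auto split: if_splits)
  next
    fix i s i' j' r' assume vw: "v = D i' j' r'" "w = C i s"
    show ?thesis using eqB unfolding vw Bs by (auto split: if_splits)
  qed (use v w in \<open>auto simp: base_def\<close>)
qed

lemma parents_hood: "v \<notin> base q \<Longrightarrow> parents q v \<subseteq> hood q v"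
  by (cases v) auto

lemma parents_base: "v \<in> base q \<Longrightarrow> parents q v \<subseteq> base q"
  by (auto simp: base_def)

lemma stw_the_graph:
  assumes q: "2 \<le> q" and L: "1 \<le> L"
  shows "stw (the_graph q L) \<le> q + 1"
proof -
  let ?T = "\<lparr>verts = to_nat ` vertices q L, edges = {{to_nat u, to_nat w} | u w.
    u \<in> vertices q L \<and> w \<in> vertices q L \<and> u \<noteq> w \<and>
    ({u, w} \<subseteq> base q \<or> (w \<notin> base q \<and> u \<in> hood q w))}\<rparr>"
  have "simple_ktree_constr (q + 1) ?T ((\<lambda>v. to_nat ` hood q v) ` (vertices q L - base q))"
  proof (rule simple_ktree_constr_by_rank[where rank = "rank q L"])
    show "base q \<subseteq> vertices q L" using L by (auto simp: base_def)
    show "card (base q) = q + 1 + 1"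
      unfolding base_def by (subst card_Un_disjoint) (auto simp: card_image inj_on_def)
  qed (use finite_vertices card_hood[OF q] hood_vertices[OF q] rank_hood[OF q] clique_hood[OF q]
      inj_on_hood[OF q] in auto)
  then have "simple_ktree (q + 1) ?T" by (auto simp: simple_ktree_def)
  moreover have "subgraph (the_graph q L) ?T"
  proof -
    have "simple_graph ?T" using finite_vertices by (auto simp: simple_graph_def card_insert_if)
    moreover have "{to_nat v, to_nat u} \<in> edges ?T" if "v \<in> vertices q L" "u \<in> parents q v" for u v
    proof -
      have "u \<in> vertices q L" "u \<noteq> v" using that parents_vertices parents_neq by blast+
      moreover have "{u, v} \<subseteq> base q \<or> (v \<notin> base q \<and> u \<in> hood q v)"
        using that parents_hood parents_base by blast
      ultimately have "{to_nat u, to_nat v} \<in> edges ?T" using that by auto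
      then show ?thesis by (simp only: insert_commute)
    qed
    ultimately show ?thesis using simple_the_graph by (auto simp: subgraph_def the_graph_def)
  qed
  ultimately show ?thesis unfolding stw_def by (intro Least_le) blast
qed

theorem theorem16:
  fixes k :: nat
  assumes "k \<ge> 3"
  shows "\<exists>G :: nat ugraph. bipartite G \<and>
           stw G + 1 \<le> k + 1 \<and> k + 1 \<le> caterpillar_arboricity G \<and>
           caterpillar_arboricity G = track_number G"
proof -
  define q where "q = k - 1"
  define L where "L = Suc (2 * q * Suc q)"
  have q: "2 \<le> q" "k = q + 1" using assms by (auto simp: q_def)
  have L: "2 * q * Suc q < L" "1 \<le> L" by (auto simp: L_def)
  let ?G = "the_graph q L"
  have bip: "bipartite ?G" by (rule bipartite_the_graph)
  have "caterpillar_arboricity ?G = q + 2"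
    unfolding caterpillar_arboricity_def
    by (rule cover_number_the_graph[OF q(1) L(1)]) (auto intro: caterpillar_forest_few_inner)
  moreover have "track_number ?G = q + 2"
    unfolding track_number_def
  proof (rule cover_number_the_graph[OF q(1) L(1)])
    \<comment> \<open>An interval subgraph inherits the absence of triangles from the bipartite
      graph.\<close>
    fix H assume H: "interval_graph H" "subgraph H ?G"
    then have "edges H \<subseteq> edges ?G" by (simp add: subgraph_def)
    then show "few_inner H"
      using bipartite_no_triangle[OF bip] by (intro interval_graph_few_inner[OF H(1)]) blast
  qed
  ultimately show ?thesis using bip stw_the_graph[OF q(1) L(2)] q(2) by (intro exI[of _ ?G]) simp
qed

end
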